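(* $[3,1,0,1]=4$. That is: let $n\ge 4$ and let $g$, $r$, $r_1$ be one green vertex $g$ and two distinct red vertices $r,r_1$ in $\mathcal{Q}_n$. Let $g_1$ and $g_2$ be two distinct green vertices in $\mathcal{Q}_n-\{g,r,r_1\}$. Then there exists a Hamiltonian path of $\mathcal{Q}_n-\{g,r,r_1\}$ connecting $g_1$ to $g_2$. The claim is not true for $n=3$ (there are such vertices in $\mathcal{Q}_3$ for which no such Hamiltonian path exists).
   Context: $\mathcal{Q}_n$ is the $n$-dimensional binary hypercube: its vertices are all binary sequences of length $n$, adjacent iff they differ in exactly one position. A vertex is even or odd according to the parity of its number of 1's; vertices of one parity are called red and those of the other parity green. A path covering of a graph is a set of vertex-disjoint paths that cover all vertices of the graph. A fault $\mathcal{F}$ in $\mathcal{Q}_n$ is a set of deleted vertices; its mass is $|\mathcal{F}|$ and its charge is $|r(\mathcal{F})-g(\mathcal{F})|$, where $r(\mathcal{F})$, $g(\mathcal{F})$ are the numbers of red and green vertices in $\mathcal{F}$. $\mathcal{Q}_n-\mathcal{F}$ is the subgraph induced by the non-deleted vertices. A pair of vertices (or a path, via its two endpoints) is neutral if the two vertices have opposite parity and charged if they have the same parity; a charged pair is red (green) if its elements are red (green). A set $\mathcal{E}$ of disjoint pairs of vertices is in balance with $\mathcal{F}$ if all vertices in the pairs lie in $\mathcal{Q}_n-\mathcal{F}$ and $r(\mathcal{F})-g(\mathcal{F})=g(\mathcal{E})-r(\mathcal{E})$, where $r(\mathcal{E})$, $g(\mathcal{E})$ are the numbers of red and green pairs in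 $\mathcal{E}$. For a fault $\mathcal{F}$ of mass $M$ and charge $C$ in $\mathcal{Q}_n$, one can freely prescribe ends for a path covering of $\mathcal{Q}_n-\mathcal{F}$ with $N$ neutral paths and $O$ charged paths if (i) there is at least one set $\mathcal{E}$ of disjoint pairs of vertices in balance with $\mathcal{F}$ containing exactly $N$ neutral and $O$ charged pairs, and (ii) for every such $\mathcal{E}$ there is a path covering of $\mathcal{Q}_n-\mathcal{F}$ whose set of pairs of end vertices is $\mathcal{E}$. For nonnegative integers $M,C,N,O$, $\mathcal{A}_{M,C,N,O}$ is the set of nonnegative integers $m$ such that $m\ge\log_2[M+C+2N+2O]$ and for every $n\ge m$ and every fault $\mathcal{F}$ of mass $M$ and charge $C$ in $\mathcal{Q}_n$ one can freely prescribe ends for a path covering of $\mathcal{Q}_n-\mathcal{F}$ with $N$ neutral and $O$ charged paths. $[M,C,N,O]$ is the smallest element of $\mathcal{A}_{M,C,N,O}$ if this set is nonempty. *)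

theory Defs
  imports Complex_Main
begin

definition cube :: "nat \<Rightarrow> bool list set" where
  "cube n = {v. length v = n}"

definition adj :: "bool list \<Rightarrow> bool list \<Rightarrow> bool" where
  "adj u v \<longleftrightarrow> length u = length v \<and> card {i. i < length u \<and> u ! i \<noteq> v ! i} = 1"

definition even_vertex :: "bool list \<Rightarrow> bool" where
  "even_vertex v \<longleftrightarrow> even (count_list v True)"

(* Which of the two parity classes is called red is left open: the parameter c says
   whether the even vertices are the red ones. *)

definition red :: "bool \<Rightarrow> bool list \<Rightarrow> bool" where
  "red c v \<longleftrightarrow> (even_vertex v \<longleftrightarrow> c)"

definition green :: "bool \<Rightarrow> bool list \<Rightarrow> bool" where
  "green c v \<longleftrightarrow> \<not> red c v"

definition fault :: "nat \<Rightarrow> bool list set \<Rightarrow> bool" where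
  "fault n F \<longleftrightarrow> F \<subseteq> cube n"

definition mass :: "bool list set \<Rightarrow> nat" where
  "mass F = card F"

definition signed_charge :: "bool \<Rightarrow> bool list set \<Rightarrow> int" where
  "signed_charge c F = int (card {v \<in> F. red c v}) - int (card {v \<in> F. green c v})"

definition charge :: "bool \<Rightarrow> bool list set \<Rightarrow> nat" where
  "charge c F = nat \<bar>signed_charge c F\<bar>"

(* Pairs of vertices are unordered pairs of two distinct vertices. *)

definition neutral_pair :: "bool list set \<Rightarrow> bool" where
  "neutral_pair P \<longleftrightarrow> (\<exists>u v. P = {u, v} \<and> u \<noteq> v \<and> even_vertex u \<noteq> even_vertex v)"

definition charged_pair :: "bool list set \<Rightarrow> bool" where
  "charged_pair P \<longleftrightarrow> (\<exists>u v. P = {u, v} \<and> u \<noteq> v \<and> even_vertex u = even_vertex v)"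

definition red_pair :: "bool \<Rightarrow> bool list set \<Rightarrow> bool" where
  "red_pair c P \<longleftrightarrow> charged_pair P \<and> (\<forall>v\<in>P. red c v)"

definition green_pair :: "bool \<Rightarrow> bool list set \<Rightarrow> bool" where
  "green_pair c P \<longleftrightarrow> charged_pair P \<and> (\<forall>v\<in>P. green c v)"

definition disjoint_pairs :: "bool list set set \<Rightarrow> bool" where
  "disjoint_pairs E \<longleftrightarrow> (\<forall>P\<in>E. card P = 2) \<and> pairwise disjnt E"

definition in_balance :: "bool \<Rightarrow> nat \<Rightarrow> bool list set \<Rightarrow> bool list set set \<Rightarrow> bool" where
  "in_balance c n F E \<longleftrightarrow> disjoint_pairs E \<and> \<Union>E \<subseteq> cube n - F \<and>
     signed_charge c F
       = int (card {P \<in> E. green_pair c P}) - int (card {P \<in> E. red_pair c P})"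

(* The following notions refer to the subgraph of a hypercube induced by the vertex set V;
   in particular V = cube n - F gives the hypercube with the fault F deleted.
   A path is given by the list of its vertices. *)

definition path_in :: "bool list set \<Rightarrow> bool list list \<Rightarrow> bool" where
  "path_in V p \<longleftrightarrow> p \<noteq> [] \<and> distinct p \<and> set p \<subseteq> V \<and> successively adj p"

definition ends :: "bool list list \<Rightarrow> bool list set" where
  "ends p = {hd p, last p}"

(* No path is listed together with its reversal, since their vertex sets would meet. *)
definition path_covering :: "bool list set \<Rightarrow> bool list list set \<Rightarrow> bool" where
  "path_covering V X \<longleftrightarrow> (\<forall>p\<in>X. path_in V p) \<and>
     pairwise (\<lambda>p q. disjnt (set p) (set q)) X \<and> (\<Union>p\<in>X. set p) = V"

definition hamiltonian_path :: "bool list set \<Rightarrow> bool list list \<Rightarrow> bool" where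
  "hamiltonian_path V p \<longleftrightarrow> path_in V p \<and> set p = V"

definition prescription ::
  "bool \<Rightarrow> nat \<Rightarrow> bool list set \<Rightarrow> nat \<Rightarrow> nat \<Rightarrow> bool list set set \<Rightarrow> bool" where
  "prescription c n F N K E \<longleftrightarrow> in_balance c n F E \<and>
     card {P \<in> E. neutral_pair P} = N \<and> card {P \<in> E. charged_pair P} = K"

definition freely_prescribable ::
  "bool \<Rightarrow> nat \<Rightarrow> bool list set \<Rightarrow> nat \<Rightarrow> nat \<Rightarrow> bool" where
  "freely_prescribable c n F N K \<longleftrightarrow>
     (\<exists>E. prescription c n F N K E) \<and>
     (\<forall>E. prescription c n F N K E \<longrightarrow> (\<exists>X. path_covering (cube n - F) X \<and> ends ` X = E))"

definition admissible :: "bool \<Rightarrow> nat \<Rightarrow> nat \<Rightarrow> nat \<Rightarrow> nat \<Rightarrow> nat set" where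
  "admissible c M C N K =
     {m. real m \<ge> log 2 (real (M + C + 2 * N + 2 * K)) \<and>
         (\<forall>n\<ge>m. \<forall>F. fault n F \<and> mass F = M \<and> charge c F = C \<longrightarrow>
            freely_prescribable c n F N K)}"

(* Meaningful only if the admissible set is nonempty. *)
definition bracket :: "bool \<Rightarrow> nat \<Rightarrow> nat \<Rightarrow> nat \<Rightarrow> nat \<Rightarrow> nat" where
  "bracket c M C N K = (LEAST m. m \<in> admissible c M C N K)"

end

theory Submission
  imports Defs
begin

text \<open>
  Cut the cube into two halves along a coordinate in which the two deleted vertices \<open>r\<close>, \<open>r'\<close> of
  the same parity differ. The third deleted vertex \<open>g\<close> lies in one of the halves, so one half \<open>A\<close>
  loses two vertices of opposite parity and the other half \<open>B\<close> loses a single vertex. Half \<open>B\<close> is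
  traversable between any two vertices of the parity that has the surplus
  (\<open>cube_minus_vertex_traceable\<close>), and half \<open>A\<close> between any two surviving vertices of opposite
  parity, provided that its dimension is at least four (\<open>cube_minus_two_traceable\<close>). How the two
  traversals are combined depends on the position of the prescribed ends:

  \<^item> one end in each half: the two traversals are joined by one crossing edge;
  \<^item> both ends in \<open>B\<close>: the traversal of \<open>B\<close> leaves at some edge \<open>x y\<close>, and the neighbours of \<open>x\<close>
    and \<open>y\<close> in \<open>A\<close> are the ends of a traversal of \<open>A\<close>;
  \<^item> both ends in \<open>A\<close>: a path that visits all of \<open>A\<close> except \<open>r\<close>, hence also \<open>g\<close>, is cut at \<open>g\<close>; the two
    neighbours of \<open>g\<close> on it have neighbours in \<open>B\<close> that are the ends of a traversal of \<open>B\<close>.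

  The result with two faults follows in the same way by induction on the dimension, with a cut that
  separates a deleted vertex from the prescribed end of the same parity. It fails in dimension three,
  which leaves dimension four without halves to build on; there both statements are verified by an
  exhaustive search, after translating one deleted vertex to the origin.

  In dimension three, faults and ends can be chosen such that some vertex that has to be an inner
  vertex of the path has a single neighbour left (\<open>cube3_obstruction\<close>).
\<close>

section \<open>Adjacency and parity\<close>

text \<open>Adjacency and parity by recursion on the vertex, which serves induction as well as evaluation.\<close>

lemma adj_Cons [code]:
  "adj [] [] = False"
  "adj (x # xs) [] = False"
  "adj [] (y # ys) = False"
  "adj (x # xs) (y # ys) = (if x = y then adj xs ys else xs = ys)"
proof -
  show "adj [] [] = False" "adj (x # xs) [] = False" "adj [] (y # ys) = False"
    by (simp_all add: adj_def)
  define D where "D = {i. i < length xs \<and> xs ! i \<noteq> ys ! i}"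
  have D: "{i. i < length (x # xs) \<and> (x # xs) ! i \<noteq> (y # ys) ! i}
      = (if x = y then {} else {0}) \<union> Suc ` D"
    unfolding D_def by (auto simp: image_iff less_Suc_eq_0_disj)
  have "finite D" unfolding D_def by simp
  then have "card {i. i < length (x # xs) \<and> (x # xs) ! i \<noteq> (y # ys) ! i}
      = (if x = y then 0 else 1) + card D"
    unfolding D by (subst card_Un_disjoint) (auto simp: card_image)
  moreover have "card D = 0 \<longleftrightarrow> D = {}"
    using \<open>finite D\<close> by simp
  moreover have "length xs = length ys \<Longrightarrow> D = {} \<longleftrightarrow> xs = ys"
    unfolding D_def by (auto simp: list_eq_iff_nth_eq)
  ultimately show "adj (x # xs) (y # ys) = (if x = y then adj xs ys else xs = ys)"
    unfolding adj_def D_def[symmetric] by auto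
qed

lemma even_vertex_Cons [code]:
  "even_vertex [] = True"
  "even_vertex (x # xs) = (if x then \<not> even_vertex xs else even_vertex xs)"
  by (auto simp: even_vertex_def)

lemma adj_sym: "adj u v \<Longrightarrow> adj v u"
  by (simp add: adj_def eq_commute)

lemma adj_parity: "adj u v \<Longrightarrow> even_vertex u \<noteq> even_vertex v"
proof (induction u arbitrary: v)
  case Nil
  then show ?case by (cases v) (simp_all add: adj_Cons)
next
  case (Cons x u)
  then show ?case
    by (cases v) (auto simp: adj_Cons even_vertex_Cons split: if_splits)
qed

lemma finite_cube [simp]: "finite (cube n)"
  and card_cube: "card (cube n) = 2 ^ n"
  using finite_lists_length_eq[of "UNIV :: bool set" n] card_lists_length_eq[of "UNIV :: bool set" n]
  by (simp_all add: cube_def)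

section \<open>Joining and cutting Hamiltonian paths\<close>

definition traceable :: "bool list set \<Rightarrow> bool list \<Rightarrow> bool list \<Rightarrow> bool" where
  "traceable V a b \<longleftrightarrow> (\<exists>p. hamiltonian_path V p \<and> hd p = a \<and> last p = b)"

lemma traceableI:
  assumes "p \<noteq> []" "distinct p" "successively adj p" "hd p = a" "last p = b" "set p = V"
  shows "traceable V a b"
  using assms unfolding traceable_def hamiltonian_path_def path_in_def by blast

lemma traceableE:
  assumes "traceable V a b"
  obtains p where "p \<noteq> []" "distinct p" "successively adj p" "hd p = a" "last p = b" "set p = V"
  using assms unfolding traceable_def hamiltonian_path_def path_in_def by blast

lemma traceable_ends: "traceable V a b \<Longrightarrow> a \<in> V \<and> b \<in> V"
  by (metis traceableE hd_in_set last_in_set)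

lemma traceable_singleton: "traceable {a} a a"
  by (rule traceableI[of "[a]"]) simp_all

lemma traceable_rev:
  assumes "traceable V a b"
  shows "traceable V b a"
proof -
  from assms obtain p where p: "p \<noteq> []" "distinct p" "successively adj p" "hd p = a" "last p = b" "set p = V"
    by (rule traceableE)
  have "successively adj (rev p)"
    unfolding successively_rev using p(3) by (rule successively_mono) (auto intro: adj_sym)
  with p show ?thesis
    by (intro traceableI[of "rev p"]) (simp_all add: hd_rev last_rev)
qed

lemma traceable_join:
  assumes "traceable V a x" "traceable W y b" "adj x y" "V \<inter> W = {}"
  shows "traceable (V \<union> W) a b"
proof -
  from assms(1) obtain p where p: "p \<noteq> []" "distinct p" "successively adj p" "hd p = a" "last p = x" "set p = V"
    by (rule traceableE)
  from assms(2) obtain q where q: "q \<noteq> []" "distinct q" "successively adj q" "hd q = y" "last q = b" "set q = W"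
    by (rule traceableE)
  show ?thesis
    using p q assms(3,4)
    by (intro traceableI[of "p @ q"]) (auto simp: successively_append_iff)
qed

text \<open>A Hamiltonian path on \<open>2k + 2\<close> vertices contains \<open>k + 1\<close> disjoint edges, and a set of \<open>k\<close> vertices
  cannot meet all of them.\<close>

lemma traceable_cut_edge:
  assumes V: "traceable V a b" and S: "finite S" "2 * card S + 2 \<le> card V"
  obtains x y V1 V2 where "V = V1 \<union> V2" "V1 \<inter> V2 = {}"
    "traceable V1 a x" "traceable V2 y b" "adj x y" "x \<notin> S" "y \<notin> S"
proof -
  from V obtain p where p: "p \<noteq> []" "distinct p" "successively adj p" "hd p = a" "last p = b" "set p = V"
    by (rule traceableE)
  have len: "length p = card V"
    using p(2,6) distinct_card by metis
  \<comment> \<open>The pairs of positions \<open>2k\<close>, \<open>2k + 1\<close> are disjoint, so \<open>S\<close> meets at most \<open>card S\<close> of them.\<close>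
  have "\<exists>k \<le> card S. p ! (2 * k) \<notin> S \<and> p ! (2 * k + 1) \<notin> S"
  proof (rule ccontr)
    assume "\<not> ?thesis"
    then have "\<forall>k\<in>{..card S}. \<exists>j. (j = 2 * k \<or> j = 2 * k + 1) \<and> p ! j \<in> S"
      by auto
    from bchoice[OF this] obtain h where
      h: "\<And>k. k \<le> card S \<Longrightarrow> (h k = 2 * k \<or> h k = 2 * k + 1) \<and> p ! h k \<in> S"
      by auto
    have "inj_on (\<lambda>k. p ! h k) {..card S}"
    proof (rule inj_onI)
      fix k l assume kl: "k \<in> {..card S}" "l \<in> {..card S}" "p ! h k = p ! h l"
      have "h k < length p" "h l < length p"
        using h[of k] h[of l] kl(1,2) S(2) len by auto
      with kl(3) p(2) have "h k = h l" by (simp add: nth_eq_iff_index_eq)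
      then show "k = l" using h[of k] h[of l] kl(1,2) by auto
    qed
    moreover have "(\<lambda>k. p ! h k) ` {..card S} \<subseteq> S" using h by auto
    ultimately have "card {..card S} \<le> card S" using S(1) by (rule card_inj_on_le)
    then show False by simp
  qed
  then obtain k where k: "k \<le> card S" "p ! (2 * k) \<notin> S" "p ! (2 * k + 1) \<notin> S"
    by blast
  define j where "j = Suc (2 * k)"
  have j: "0 < j" "j < length p" using k(1) S(2) len by (auto simp: j_def)
  let ?p1 = "take j p" and ?p2 = "drop j p"
  have ne: "?p1 \<noteq> []" "?p2 \<noteq> []" using j by auto
  have x: "last ?p1 = p ! (2 * k)"
    using j by (simp add: j_def take_Suc_conv_app_nth)
  have y: "hd ?p2 = p ! (2 * k + 1)"
    using j by (simp add: hd_drop_conv_nth j_def)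
  have "successively adj (?p1 @ ?p2)" using p(3) by simp
  then have succ: "successively adj ?p1" "successively adj ?p2" "adj (last ?p1) (hd ?p2)"
    using ne by (auto simp only: successively_append_iff)
  have "distinct (?p1 @ ?p2)" using p(2) by simp
  then have dist: "distinct ?p1" "distinct ?p2" "set ?p1 \<inter> set ?p2 = {}"
    by (simp_all only: distinct_append)
  show thesis
  proof (rule that[of "set ?p1" "set ?p2"])
    show "V = set ?p1 \<union> set ?p2"
      using p(6) by (metis append_take_drop_id set_append)
    show "set ?p1 \<inter> set ?p2 = {}" by (rule dist)
    show "traceable (set ?p1) a (last ?p1)"
      using ne(1) dist(1) succ(1) j p(4) by (intro traceableI[of ?p1]) auto
    show "traceable (set ?p2) (hd ?p2) b"
      using ne(2) dist(2) succ(2) j p(5) by (intro traceableI[of ?p2]) auto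
  qed (use succ x y k in simp_all)
qed

lemma traceable_cut_vertex:
  assumes V: "traceable V a b" and g: "g \<in> V" "g \<noteq> a" "g \<noteq> b"
  obtains x y V1 V2 where "V - {g} = V1 \<union> V2" "V1 \<inter> V2 = {}"
    "traceable V1 a x" "traceable V2 y b" "adj x g" "adj g y"
proof -
  from V obtain p where p: "p \<noteq> []" "distinct p" "successively adj p" "hd p = a" "last p = b" "set p = V"
    by (rule traceableE)
  obtain p1 p2 where split: "p = p1 @ g # p2"
    using g(1) p(6) by (metis split_list)
  have ne: "p1 \<noteq> []" "p2 \<noteq> []"
    using split p(4,5) g by auto
  show thesis
  proof (rule that[of "set p1" "set p2"])
    show "V - {g} = set p1 \<union> set p2" "set p1 \<inter> set p2 = {}"
      using p(2,6) split by auto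
    show "traceable (set p1) a (last p1)"
      using p split ne by (intro traceableI[of p1]) (auto simp: successively_append_iff)
    show "traceable (set p2) (hd p2) b"
      using p split ne
      by (intro traceableI[of p2]) (auto simp: successively_append_iff successively_Cons)
    show "adj (last p1) g" "adj g (hd p2)"
      using p(3) split ne by (auto simp: successively_append_iff successively_Cons)
  qed
qed

section \<open>Copies of a cube and their halves\<close>

text \<open>The inductions run over the images of cubes, so that a half of a copy is again a copy and results
  on one cube need not be moved back and forth along coordinate insertions. Keeping parity relations
  is required separately to spare the argument that adjacency already determines them.\<close>

definition embedding :: "nat \<Rightarrow> (bool list \<Rightarrow> bool list) \<Rightarrow> bool list set \<Rightarrow> bool" where
  "embedding n f Q \<longleftrightarrow> bij_betw f (cube n) Q \<and>
     (\<forall>u\<in>cube n. \<forall>v\<in>cube n. adj u v \<longrightarrow> adj (f u) (f v)) \<and>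
     (\<forall>u\<in>cube n. \<forall>v\<in>cube n.
        (even_vertex (f u) = even_vertex (f v)) = (even_vertex u = even_vertex v))"

definition cube_copy :: "nat \<Rightarrow> bool list set \<Rightarrow> bool" where
  "cube_copy n Q \<longleftrightarrow> (\<exists>f. embedding n f Q)"

lemma cube_copy_cube: "cube_copy n (cube n)"
  unfolding cube_copy_def embedding_def by (rule exI[of _ id]) simp

lemma cube_copy_finite: "cube_copy n Q \<Longrightarrow> finite Q"
  and cube_copy_card: "cube_copy n Q \<Longrightarrow> card Q = 2 ^ n"
  unfolding cube_copy_def embedding_def
  using bij_betw_finite bij_betw_same_card card_cube finite_cube by metis+

lemma embedding_traceable:
  assumes f: "embedding n f Q" and V: "V \<subseteq> cube n" "traceable V a b"
  shows "traceable (f ` V) (f a) (f b)"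
proof -
  from V(2) obtain p where p: "p \<noteq> []" "distinct p" "successively adj p" "hd p = a" "last p = b" "set p = V"
    by (rule traceableE)
  have "inj_on f (cube n)" using f by (simp add: embedding_def bij_betw_def)
  then have "inj_on f (set p)" using V(1) p(6) by (auto intro: inj_on_subset)
  moreover have "successively (\<lambda>x y. adj (f x) (f y)) p"
    using p(3) by (rule successively_mono) (use f p(6) V(1) in \<open>unfold embedding_def, blast\<close>)
  ultimately show ?thesis
    using p by (intro traceableI[of "map f p"])
      (auto simp: distinct_map successively_map hd_map last_map)
qed

text \<open>The new entry \<open>b\<close> is placed at position \<open>i\<close>: for fixed \<open>i\<close> and \<open>b\<close> this embeds a cube
  as a half of the next one. The second equation is a default for positions beyond the end.\<close>

fun ins :: "nat \<Rightarrow> bool \<Rightarrow> bool list \<Rightarrow> bool list" where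
  "ins 0 b v = b # v"
| "ins (Suc i) b [] = [b]"
| "ins (Suc i) b (x # v) = x # ins i b v"

lemma length_ins: "length (ins i b v) = Suc (length v)"
  by (induction i b v rule: ins.induct) auto

lemma nth_ins: "i \<le> length v \<Longrightarrow> ins i b v ! i = b"
  by (induction i b v rule: ins.induct) auto

lemma ins_eq_iff: "length u = length v \<Longrightarrow> ins i b u = ins i b v \<longleftrightarrow> u = v"
  by (induction u v arbitrary: i rule: list_induct2) (case_tac i, auto)+

lemma adj_ins: "adj u v \<Longrightarrow> adj (ins i b u) (ins i b v)"
proof (induction i b u arbitrary: v rule: ins.induct)
  case (3 i b x u)
  then show ?case by (cases v) (auto simp: adj_Cons split: if_splits)
next
  case (2 i b)
  then show ?case by (cases v) (auto simp: adj_Cons)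
qed (auto simp: adj_Cons)

lemma adj_ins_not: "adj (ins i b v) (ins i (\<not> b) v)"
  by (induction i b v rule: ins.induct) (auto simp: adj_Cons)

lemma even_vertex_ins: "even_vertex (ins i b v) \<longleftrightarrow> even_vertex v \<noteq> b"
  by (induction i b v rule: ins.induct) (auto simp: even_vertex_Cons)

lemma ins_surj: "w \<in> cube (Suc n) \<Longrightarrow> i \<le> n \<Longrightarrow> \<exists>v\<in>cube n. w = ins i (w ! i) v"
proof (induction i arbitrary: w n)
  case 0
  then show ?case by (cases w) (auto simp: cube_def)
next
  case (Suc i)
  then obtain x w' m where w: "w = x # w'" "w' \<in> cube (Suc m)" "n = Suc m" "i \<le> m"
    by (cases w; cases n) (auto simp: cube_def)
  with Suc.IH obtain v where "v \<in> cube m" "w' = ins i (w' ! i) v" by blast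
  with w show ?case by (intro bexI[of _ "x # v"]) (auto simp: cube_def)
qed

lemma embedding_ins:
  assumes f: "embedding (Suc n) f Q"
  shows "embedding n (\<lambda>v. f (ins i b v)) ((\<lambda>v. f (ins i b v)) ` cube n)"
proof -
  have ins: "ins i b v \<in> cube (Suc n)" if "v \<in> cube n" for v
    using that by (simp add: cube_def length_ins)
  have "inj_on (\<lambda>v. f (ins i b v)) (cube n)"
  proof (rule inj_onI)
    fix u v assume uv: "u \<in> cube n" "v \<in> cube n" "f (ins i b u) = f (ins i b v)"
    then have "ins i b u = ins i b v"
      using f ins unfolding embedding_def bij_betw_def inj_on_def by blast
    with uv(1,2) show "u = v" by (auto simp: ins_eq_iff cube_def)
  qed
  then show ?thesis
    using f ins unfolding embedding_def bij_betw_def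
    by (auto simp: adj_ins even_vertex_ins)
qed

text \<open>The map \<open>s\<close> flips the coordinate along which the cube is cut.\<close>

definition halving ::
  "nat \<Rightarrow> bool list set \<Rightarrow> bool list set \<Rightarrow> bool list set \<Rightarrow> (bool list \<Rightarrow> bool list) \<Rightarrow> bool" where
  "halving n Q A B s \<longleftrightarrow> cube_copy n A \<and> cube_copy n B \<and> Q = A \<union> B \<and> A \<inter> B = {} \<and>
     (\<forall>x\<in>A. s x \<in> B) \<and> (\<forall>x\<in>B. s x \<in> A) \<and> (\<forall>x\<in>Q. adj x (s x) \<and> s (s x) = x)"

lemma halving_sym: "halving n Q A B s \<Longrightarrow> halving n Q B A s"
  unfolding halving_def by auto

lemma halving_parity: "halving n Q A B s \<Longrightarrow> x \<in> Q \<Longrightarrow> even_vertex (s x) \<longleftrightarrow> \<not> even_vertex x"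
  unfolding halving_def using adj_parity by blast

lemma halving_exists:
  assumes Q: "cube_copy (Suc n) Q" and uv: "u \<in> Q" "v \<in> Q" "u \<noteq> v"
  obtains A B s where "halving n Q A B s" "u \<in> A" "v \<in> B"
proof -
  from Q obtain f where f: "embedding (Suc n) f Q" unfolding cube_copy_def by blast
  then have im: "f ` cube (Suc n) = Q" and inj: "inj_on f (cube (Suc n))"
    by (auto simp: embedding_def bij_betw_def)
  from im uv obtain u' v' where u': "u' \<in> cube (Suc n)" "u = f u'" and v': "v' \<in> cube (Suc n)" "v = f v'"
    by blast
  then have "u' \<noteq> v'" "length u' = Suc n" "length v' = Suc n"
    using uv(3) by (auto simp: cube_def)
  then obtain i where i: "i \<le> n" "u' ! i \<noteq> v' ! i"
    by (auto simp: list_eq_iff_nth_eq less_Suc_eq_le)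
  define h where "h = (\<lambda>b v. f (ins i b v))"
  define b where "b = u' ! i"
  have ins: "ins i c w \<in> cube (Suc n)" if "w \<in> cube n" for c w
    using that by (simp add: cube_def length_ins)
  have h_eq: "c = d \<and> w = w'" if "w \<in> cube n" "w' \<in> cube n" "h c w = h d w'" for c d w w'
  proof -
    have "ins i c w = ins i d w'"
      using that ins inj unfolding h_def inj_on_def by blast
    moreover from this have "c = d"
      using nth_ins[of i w c] nth_ins[of i w' d] that i(1) by (simp add: cube_def)
    ultimately show ?thesis using that by (simp add: ins_eq_iff cube_def)
  qed
  have surj: "\<exists>w\<in>cube n. f x = h (x ! i) w" if "x \<in> cube (Suc n)" for x
    using ins_surj[OF that i(1)] unfolding h_def by metis
  define A where "A = h b ` cube n"
  define B where "B = h (\<not> b) ` cube n"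
  \<comment> \<open>A point of \<open>Q\<close> has a unique representation \<open>h c w\<close>, so the choice below recovers \<open>c\<close> and \<open>w\<close>.\<close>
  define s where "s x = (let (c, w) = (SOME (c, w). w \<in> cube n \<and> x = h c w) in h (\<not> c) w)" for x
  have s: "s (h c w) = h (\<not> c) w" if "w \<in> cube n" for c w
  proof -
    have "(SOME (d, w'). w' \<in> cube n \<and> h c w = h d w') = (c, w)"
      by (rule some_equality) (use that h_eq[OF that] in \<open>simp, blast\<close>)
    then show ?thesis by (simp add: s_def)
  qed
  have "cube_copy n A" "cube_copy n B"
    using embedding_ins[OF f] unfolding A_def B_def h_def cube_copy_def by blast+
  moreover have "Q = A \<union> B"
  proof
    show "Q \<subseteq> A \<union> B"
    proof
      fix x assume "x \<in> Q"
      then obtain x' where x': "x' \<in> cube (Suc n)" "x = f x'" using im by blast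
      with surj obtain w where "w \<in> cube n" "x = h (x' ! i) w" by blast
      then show "x \<in> A \<union> B" unfolding A_def B_def by (cases "x' ! i = b") auto
    qed
    show "A \<union> B \<subseteq> Q" using ins im unfolding A_def B_def h_def by blast
  qed
  moreover have "A \<inter> B = {}" unfolding A_def B_def using h_eq by blast
  moreover have "\<forall>x\<in>A. s x \<in> B" "\<forall>x\<in>B. s x \<in> A" "\<forall>x\<in>A \<union> B. s (s x) = x"
    unfolding A_def B_def using s by auto
  moreover have "\<forall>x\<in>A \<union> B. adj x (s x)"
  proof -
    have "adj (h c w) (s (h c w))" if "w \<in> cube n" for c w
      using f ins that adj_ins_not[of i c w] unfolding s[OF that] by (simp add: embedding_def h_def)
    then show ?thesis unfolding A_def B_def by auto
  qed
  ultimately have "halving n Q A B s" unfolding halving_def by auto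
  moreover have "u \<in> A"
    using surj[OF u'(1)] u'(2) unfolding A_def b_def by blast
  moreover have "v \<in> B"
  proof -
    have "(\<not> b) = v' ! i" using i(2) by (simp add: b_def)
    then show ?thesis using surj[OF v'(1)] v'(2) unfolding B_def by (simp only:) blast
  qed
  ultimately show thesis by (rule that)
qed

text \<open>Flipping a coordinate changes parity, so each of the edges in that direction has exactly one end of
  parity \<open>e\<close>; these edges correspond to the vertices of one half.\<close>

lemma cube_copy_parity_class:
  assumes Q: "cube_copy (Suc n) Q"
  shows "card {x \<in> Q. even_vertex x = e} = 2 ^ n"
proof -
  have Q2: "finite Q" "card Q = 2 * 2 ^ n"
    using cube_copy_finite[OF Q] cube_copy_card[OF Q] by simp_all
  have "\<not> card Q \<le> card {}" using Q2 by simp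
  then obtain u where u: "u \<in> Q" by force
  have "Q \<noteq> {u}"
  proof
    assume "Q = {u}"
    with Q2 have "1 = 2 * (2::nat) ^ n" by simp
    then show False by presburger
  qed
  with u obtain v where "u \<in> Q" "v \<in> Q" "u \<noteq> v" by blast
  from halving_exists[OF Q this] obtain A B s where h: "halving n Q A B s" .
  have par: "even_vertex (s x) \<longleftrightarrow> \<not> even_vertex x" if "x \<in> Q" for x
    using halving_parity[OF h that] .
  define t where "t x = (if even_vertex x = e then x else s x)" for x
  have "bij_betw t A {x \<in> Q. even_vertex x = e}"
  proof (rule bij_betwI')
    fix x y assume xy: "x \<in> A" "y \<in> A"
    have "s x \<noteq> y" "s y \<noteq> x" "s (s x) = x" "s (s y) = y"
      using xy h unfolding halving_def by blast+
    then have "x = y" if "t x = t y"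
      using that unfolding t_def by (metis)
    then show "t x = t y \<longleftrightarrow> x = y" by auto
  next
    fix x assume "x \<in> A"
    then have "x \<in> Q" "s x \<in> Q" using h unfolding halving_def by blast+
    then show "t x \<in> {x \<in> Q. even_vertex x = e}"
      using par[of x] by (auto simp: t_def)
  next
    fix y assume y: "y \<in> {x \<in> Q. even_vertex x = e}"
    show "\<exists>x\<in>A. y = t x"
    proof (cases "y \<in> A")
      case True
      then show ?thesis using y by (intro bexI[of _ y]) (auto simp: t_def)
    next
      case False
      then have "y \<in> B" using y h unfolding halving_def by blast
      then have "s y \<in> A" "s (s y) = y" using h y unfolding halving_def by blast+
      then show ?thesis using y par[of y]
        by (intro bexI[of _ "s y"]) (simp_all add: t_def)
    qed
  qed
  then have "card {x \<in> Q. even_vertex x = e} = card A" by (simp add: bij_betw_same_card)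
  also have "\<dots> = 2 ^ n" using h by (simp add: halving_def cube_copy_card)
  finally show ?thesis .
qed

lemma cube_copy_avoid:
  assumes Q: "cube_copy n Q" "0 < n" and S: "finite S" "card S < 2 ^ (n - 1)"
  obtains x where "x \<in> Q" "even_vertex x = e" "x \<notin> S"
proof -
  obtain m where n: "n = Suc m" using Q(2) by (cases n) auto
  have "card S < card {x \<in> Q. even_vertex x = e}"
    using cube_copy_parity_class[of m Q e] Q(1) S(2) n by simp
  then have "\<not> {x \<in> Q. even_vertex x = e} \<subseteq> S"
    using card_mono[OF S(1)] leD by blast
  then show thesis using that by blast
qed

lemma halvingD:
  assumes "halving n Q A B s"
  shows "cube_copy n A" "cube_copy n B" "Q = A \<union> B" "A \<inter> B = {}"
    "\<And>x. x \<in> A \<Longrightarrow> s x \<in> B" "\<And>x. x \<in> B \<Longrightarrow> s x \<in> A"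
    "\<And>x. x \<in> Q \<Longrightarrow> adj x (s x)" "\<And>x. x \<in> Q \<Longrightarrow> s (s x) = x"
  using assms unfolding halving_def by blast+

lemma traceable_cross:
  assumes h: "halving n Q A B s"
    and V: "V \<subseteq> A" "traceable V a x" and W: "W \<subseteq> B" "traceable W (s x) b"
  shows "traceable (V \<union> W) a b"
proof (rule traceable_join[OF V(2) W(2)])
  have "x \<in> Q" using traceable_ends[OF V(2)] V(1) halvingD(3)[OF h] by blast
  then show "adj x (s x)" by (rule halvingD(7)[OF h])
  show "V \<inter> W = {}" using V(1) W(1) halvingD(4)[OF h] by blast
qed

text \<open>The path from \<open>a\<close> to \<open>b\<close> stays in \<open>A\<close> until \<open>x\<close>, traverses \<open>W\<close> in the other half, and resumes at \<open>y\<close>.\<close>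

lemma traceable_detour:
  assumes h: "halving n Q A B s"
    and V: "V1 \<union> V2 \<subseteq> A" "V1 \<inter> V2 = {}" "traceable V1 a x" "traceable V2 y b"
    and W: "W \<subseteq> B" "traceable W (s x) (s y)"
  shows "traceable (V1 \<union> V2 \<union> W) a b"
proof -
  have y: "y \<in> Q" "s y \<in> Q"
    using traceable_ends[OF V(4)] V(1) halvingD(3,5)[OF h] by blast+
  have "traceable (V1 \<union> W) a (s y)"
    by (rule traceable_cross[OF h _ V(3) W]) (use V(1) in blast)
  moreover have "adj (s y) y"
    using halvingD(7)[OF h y(1)] by (rule adj_sym)
  moreover have "(V1 \<union> W) \<inter> V2 = {}"
    using V(1,2) W(1) halvingD(4)[OF h] by blast
  ultimately have "traceable (V1 \<union> W \<union> V2) a b"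
    by (intro traceable_join[OF _ V(4)])
  moreover have "V1 \<union> W \<union> V2 = V1 \<union> V2 \<union> W" by blast
  ultimately show ?thesis by simp
qed

section \<open>Coverings by one path with at most two faults\<close>

text \<open>Cut between the ends \<open>u\<close> and \<open>v\<close>, traverse the first half to a vertex of the parity of \<open>v\<close> and cross.\<close>

theorem cube_laceable:
  assumes "cube_copy n Q" "u \<in> Q" "v \<in> Q" "even_vertex u \<noteq> even_vertex v"
  shows "traceable Q u v"
  using assms
proof (induction n arbitrary: Q u v)
  case 0
  then have "card Q = 1" using cube_copy_card by fastforce
  with 0 show ?case by (metis card_1_singletonE singletonD)
next
  case (Suc n)
  then have "u \<noteq> v" by blast
  with Suc.prems obtain A B s where h: "halving n Q A B s" and uv: "u \<in> A" "v \<in> B"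
    by (metis halving_exists)
  note hD = halvingD[OF h]
  have "\<exists>x. x \<in> A \<and> traceable A u x \<and> traceable B (s x) v"
  proof (cases n)
    case 0
    have "card A = 1" "card B = 1"
      using 0 cube_copy_card[OF hD(1)] cube_copy_card[OF hD(2)] by simp_all
    then have "A = {u}" "B = {v}" using uv by (auto simp: card_1_singleton_iff)
    then show ?thesis using hD(5)[of u] traceable_singleton by auto
  next
    case (Suc m)
    then obtain x where x: "x \<in> A" "even_vertex x = even_vertex v"
      using cube_copy_avoid[OF hD(1), of "{}" "even_vertex v"] by auto
    have "even_vertex (s x) \<noteq> even_vertex v"
      using halving_parity[OF h, of x] x hD(3) by blast
    then show ?thesis
      using Suc.IH[OF hD(1) uv(1) x(1)] Suc.IH[OF hD(2) hD(5)[OF x(1)] uv(2)] x Suc.prems(4) by auto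
  qed
  then show ?case
    using traceable_cross[OF h subset_refl _ subset_refl] hD(3) by metis
qed

text \<open>With one end in each half, the faulty half is traversed from \<open>a\<close> to some \<open>x\<close> of the same parity, and the
  complete half from the neighbour of \<open>x\<close> on. When the halves are single edges, \<open>x\<close> has to be \<open>a\<close> itself.\<close>

lemma cube_minus_vertex_halved:
  assumes h: "halving n Q A B s"
    and IH: "\<And>a b. a \<in> A \<Longrightarrow> b \<in> A \<Longrightarrow> a \<noteq> b \<Longrightarrow> even_vertex a = even_vertex b \<Longrightarrow>
      even_vertex r \<noteq> even_vertex a \<Longrightarrow> traceable (A - {r}) a b"
    and r: "r \<in> A" and ab: "a \<in> A" "b \<in> B"
    and par: "even_vertex a = even_vertex b" "even_vertex r \<noteq> even_vertex a"
  shows "traceable (Q - {r}) a b"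
proof -
  note hD = halvingD[OF h]
  have "\<exists>x. x \<in> A \<and> even_vertex x = even_vertex a \<and> traceable (A - {r}) a x"
  proof (cases "n \<le> 1")
    case True
    then have "(2::nat) ^ n \<le> 2 ^ 1" by (intro power_increasing) auto
    then have "card A \<le> 2" using cube_copy_card[OF hD(1)] by simp
    moreover have "card {r, a} = 2" using par(2) by (auto simp: card_insert_if)
    ultimately have "A = {r, a}"
      using card_seteq[of A "{r, a}"] r ab(1) cube_copy_finite[OF hD(1)] by simp
    then have "A - {r} = {a}" using par(2) by auto
    then show ?thesis using ab(1) traceable_singleton by auto
  next
    case False
    then have "(2::nat) ^ 1 \<le> 2 ^ (n - 1)" by (intro power_increasing) auto
    then obtain x where "x \<in> A" "even_vertex x = even_vertex a" "x \<notin> {a}"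
      using cube_copy_avoid[OF hD(1), of "{a}" "even_vertex a"] False by auto
    then show ?thesis using IH[of a x] ab(1) par(2) by auto
  qed
  then obtain x where x: "x \<in> A" "even_vertex x = even_vertex a" "traceable (A - {r}) a x"
    by blast
  have "even_vertex (s x) \<noteq> even_vertex b"
    using halving_parity[OF h, of x] x(1,2) par(1) hD(3) by blast
  then have "traceable B (s x) b"
    by (rule cube_laceable[OF hD(2) hD(5)[OF x(1)] ab(2)])
  then have "traceable ((A - {r}) \<union> B) a b"
    by (intro traceable_cross[OF h _ x(3)]) auto
  moreover have "(A - {r}) \<union> B = Q - {r}" using hD(3,4) r by blast
  ultimately show ?thesis by simp
qed

theorem cube_minus_vertex_traceable:
  assumes "cube_copy n Q" "r \<in> Q" "a \<in> Q" "b \<in> Q" "a \<noteq> b"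
    "even_vertex a = even_vertex b" "even_vertex r \<noteq> even_vertex a"
  shows "traceable (Q - {r}) a b"
  using assms
proof (induction n arbitrary: Q r a b)
  case 0
  then have "card Q = 1" using cube_copy_card by fastforce
  with 0 show ?case by (metis card_1_singletonE singletonD)
next
  case (Suc n)
  then obtain A B s where h: "halving n Q A B s" and ab: "a \<in> A" "b \<in> B"
    by (metis halving_exists)
  note hD = halvingD[OF h]
  show ?case
  proof (cases "r \<in> A")
    case True
    then show ?thesis
      using Suc.IH[OF hD(1) True] Suc.prems(6,7) ab
      by (intro cube_minus_vertex_halved[OF h]) auto
  next
    case False
    then have r: "r \<in> B" using Suc.prems(2) hD(3) by blast
    have "traceable (Q - {r}) b a"
      using Suc.IH[OF hD(2) r] Suc.prems(6,7) ab r
      by (intro cube_minus_vertex_halved[OF halving_sym[OF h]]) auto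
    then show ?thesis by (rule traceable_rev)
  qed
qed

section \<open>Exhaustive search in the four-dimensional cube\<close>

text \<open>Evaluation by rewriting is lazy only in conditionals, not in disjunctions. The search therefore
  branches with \<open>if\<close>, so that it stops at the first path found.\<close>

primrec any :: "('a \<Rightarrow> bool) \<Rightarrow> 'a list \<Rightarrow> bool" where
  "any P [] = False"
| "any P (x # xs) = (if P x then True else any P xs)"

lemma any_iff: "any P xs \<longleftrightarrow> (\<exists>x\<in>set xs. P x)"
  by (induction xs) auto

text \<open>Depth-first search for a path that starts in \<open>u\<close>, visits all of the list \<open>R\<close> of remaining vertices and
  ends in \<open>t\<close>; the number \<open>k\<close> is the length of \<open>R\<close>.\<close>

primrec route :: "nat \<Rightarrow> bool list \<Rightarrow> bool list \<Rightarrow> bool list list \<Rightarrow> bool" where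
  "route 0 u t R = (u = t)"
| "route (Suc k) u t R = (if u = t then False
     else any (\<lambda>w. if adj u w then route k w t (remove1 w R) else False) R)"

primrec bits :: "nat \<Rightarrow> bool list list" where
  "bits 0 = [[]]"
| "bits (Suc n) = map (Cons False) (bits n) @ map (Cons True) (bits n)"

definition routable :: "bool list list \<Rightarrow> bool list \<Rightarrow> bool list \<Rightarrow> bool" where
  "routable D u t =
     (let R = filter (\<lambda>w. w \<noteq> u \<and> \<not> List.member D w) (bits 4) in route (length R) u t R)"

lemma set_bits: "set (bits n) = cube n"
proof (induction n)
  case (Suc n)
  have "cube (Suc n) = Cons False ` cube n \<union> Cons True ` cube n"
    by (auto simp: cube_def length_Suc_conv image_iff)
  with Suc show ?case by simp
qed (simp add: cube_def)

lemma distinct_bits: "distinct (bits n)"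
  by (induction n) (auto simp: distinct_map)

lemma route_traceable:
  "route k u t R \<Longrightarrow> k = length R \<Longrightarrow> distinct (u # R) \<Longrightarrow> traceable (insert u (set R)) u t"
proof (induction k arbitrary: u R)
  case 0
  then show ?case by (simp add: traceable_singleton)
next
  case (Suc k)
  from Suc.prems(1) obtain w where w: "w \<in> set R" "adj u w" "route k w t (remove1 w R)"
    by (auto simp: any_iff split: if_splits)
  have R: "insert w (set (remove1 w R)) = set R"
    using w(1) Suc.prems(3) by (auto simp: set_remove1_eq)
  have "traceable (insert w (set (remove1 w R))) w t"
    using Suc.prems(2,3) w by (intro Suc.IH) (auto simp: length_remove1)
  then have "traceable ({u} \<union> set R) u t"
    unfolding R using Suc.prems(3) w(2)
    by (intro traceable_join[OF traceable_singleton]) auto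
  then show ?case by simp
qed

lemma routable_traceable:
  assumes "routable D u t" "u \<in> cube 4 - set D"
  shows "traceable (cube 4 - set D) u t"
proof -
  let ?R = "filter (\<lambda>w. w \<noteq> u \<and> \<not> List.member D w) (bits 4)"
  have "traceable (insert u (set ?R)) u t"
    using assms(1) distinct_bits by (intro route_traceable) (auto simp: routable_def Let_def)
  moreover have "insert u (set ?R) = cube 4 - set D"
    using assms(2) by (auto simp: set_bits)
  ultimately show ?thesis by simp
qed

abbreviation zero4 :: "bool list" where "zero4 \<equiv> [False, False, False, False]"

definition odd4 :: "bool list list" where
  "odd4 = filter (\<lambda>v. \<not> even_vertex v) (bits 4)"

definition even4 :: "bool list list" where
  "even4 = filter (\<lambda>v. v \<noteq> zero4 \<and> even_vertex v) (bits 4)"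

text \<open>The test \<open>b = r\<close> precedes the search because a search for an end that is deleted would fail only after
  exploring every path.\<close>

lemma search_two_faults:
  "list_all (\<lambda>r. list_all (\<lambda>a. list_all (\<lambda>b. if b = r then True else routable [zero4, r] a b)
     odd4) even4) odd4"
  by code_simp

text \<open>The deleted odd vertices and the ends are both unordered pairs, so each need be searched in one order
  only; \<open>sorted_wrt\<close> enumerates every pair of list entries once.\<close>

lemma search_three_faults:
  "sorted_wrt (\<lambda>r r'. sorted_wrt (\<lambda>a b. routable [zero4, r, r'] a b) even4) odd4"
  by code_simp

lemma sorted_wrt_distinct_pair:
  "sorted_wrt P xs \<Longrightarrow> x \<in> set xs \<Longrightarrow> y \<in> set xs \<Longrightarrow> x \<noteq> y \<Longrightarrow> P x y \<or> P y x"
  by (induction xs) auto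

text \<open>Precede an embedding with the translation by the preimage of \<open>g\<close>.\<close>

lemma embedding_at:
  assumes Q: "cube_copy n Q" "g \<in> Q"
  obtains f where "embedding n f Q" "f (replicate n False) = g"
proof -
  define tr where "tr w v = map2 (\<noteq>) w v" for w v :: "bool list"
  have len: "tr w v \<in> cube n" if "w \<in> cube n" "v \<in> cube n" for w v
    using that by (simp add: tr_def cube_def)
  have tr_tr: "tr w (tr w v) = v" if "w \<in> cube n" "v \<in> cube n" for w v
    using that by (auto simp: tr_def cube_def list_eq_iff_nth_eq)
  have tr_adj: "adj (tr w u) (tr w v) \<longleftrightarrow> adj u v"
    if "w \<in> cube n" "u \<in> cube n" "v \<in> cube n" for w u v
  proof -
    have "{i. i < length (tr w u) \<and> tr w u ! i \<noteq> tr w v ! i}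
        = {i. i < length u \<and> u ! i \<noteq> v ! i}"
      using that by (auto simp: tr_def cube_def)
    moreover have "length (tr w u) = length (tr w v)" "length u = length v"
      using that by (simp_all add: tr_def cube_def)
    ultimately show ?thesis by (simp add: adj_def)
  qed
  have tr_even: "even_vertex (tr w v) \<longleftrightarrow> even_vertex w = even_vertex v" if "length w = length v" for w v
    using that unfolding tr_def
    by (induction w v rule: list_induct2) (auto simp: even_vertex_Cons)
  from Q obtain f w where f: "embedding n f Q" and w: "w \<in> cube n" "f w = g"
    unfolding cube_copy_def embedding_def bij_betw_def by blast
  have "bij_betw (tr w) (cube n) (cube n)"
    by (rule bij_betw_byWitness[where f' = "tr w"]) (use len w(1) tr_tr in auto)
  then have "bij_betw (\<lambda>v. f (tr w v)) (cube n) Q"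
    using f bij_betw_trans[of "tr w" "cube n" "cube n" f Q] by (simp add: embedding_def comp_def)
  moreover have "adj (f (tr w u)) (f (tr w v))" if "u \<in> cube n" "v \<in> cube n" "adj u v" for u v
  proof -
    have "adj (tr w u) (tr w v)" using that w(1) tr_adj by simp
    then show ?thesis using f len[OF w(1)] that(1,2) unfolding embedding_def by blast
  qed
  moreover have "(even_vertex (f (tr w u)) = even_vertex (f (tr w v))) = (even_vertex u = even_vertex v)"
    if "u \<in> cube n" "v \<in> cube n" for u v
  proof -
    have "(even_vertex (f (tr w u)) = even_vertex (f (tr w v)))
        = (even_vertex (tr w u) = even_vertex (tr w v))"
      using f that len[OF w(1)] unfolding embedding_def by blast
    also have "\<dots> = (even_vertex u = even_vertex v)"
      using that w(1) tr_even by (auto simp: cube_def)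
    finally show ?thesis .
  qed
  ultimately have "embedding n (\<lambda>v. f (tr w v)) Q"
    unfolding embedding_def by blast
  moreover have "tr w (replicate n False) = w"
    using w(1) by (auto simp: tr_def cube_def list_eq_iff_nth_eq)
  ultimately show thesis using that w(2) by auto
qed

lemma zero4_eq: "replicate 4 False = zero4"
  by (simp add: numeral_eq_Suc)

lemma even_zero4: "even_vertex zero4"
  by (simp add: even_vertex_Cons)

lemma routable_embedding:
  assumes f: "embedding 4 f Q" and D: "set D \<subseteq> cube 4"
    and r: "routable D u t" "u \<in> cube 4 - set D"
  shows "traceable (Q - f ` set D) (f u) (f t)"
proof -
  have "traceable (f ` (cube 4 - set D)) (f u) (f t)"
    by (rule embedding_traceable[OF f _ routable_traceable[OF r]]) blast
  moreover have "f ` (cube 4 - set D) = Q - f ` set D"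
  proof -
    have "inj_on f (cube 4)" "f ` cube 4 = Q" using f by (auto simp: embedding_def bij_betw_def)
    then show ?thesis using inj_on_image_set_diff[of f "cube 4" "cube 4" "set D"] D by simp
  qed
  ultimately show ?thesis by simp
qed

lemma embedding_zero4_preimage:
  assumes f: "embedding 4 f Q" "f zero4 = g" and x: "x \<in> Q"
  obtains x' where "x' \<in> cube 4" "f x' = x" "even_vertex x' \<longleftrightarrow> even_vertex x = even_vertex g"
proof -
  from f x obtain x' where x': "x' \<in> cube 4" "f x' = x"
    unfolding embedding_def bij_betw_def by blast
  have "zero4 \<in> cube 4" by (simp add: cube_def)
  then have "even_vertex x' \<longleftrightarrow> even_vertex x = even_vertex g"
    using f x' even_zero4 unfolding embedding_def by blast
  with x' that show thesis by blast
qed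

lemma set_odd4: "set odd4 = {v \<in> cube 4. \<not> even_vertex v}"
  and set_even4: "set even4 = {v \<in> cube 4. v \<noteq> zero4 \<and> even_vertex v}"
  by (auto simp: odd4_def even4_def set_bits)

lemma cube4_minus_two:
  assumes Q: "cube_copy 4 Q" and mem: "p \<in> Q" "q \<in> Q" "u \<in> Q" "v \<in> Q"
    and par: "even_vertex p = even_vertex u" "even_vertex q = even_vertex v"
      "even_vertex p \<noteq> even_vertex q"
    and ne: "p \<noteq> u" "q \<noteq> v"
  shows "traceable (Q - {p, q}) u v"
proof -
  from embedding_at[OF Q mem(2)] obtain f where f: "embedding 4 f Q" "f zero4 = q"
    unfolding zero4_eq .
  note pre = embedding_zero4_preimage[OF f]
  obtain p' where p': "p' \<in> cube 4" "f p' = p" "\<not> even_vertex p'"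
    using pre[OF mem(1)] par by metis
  obtain u' where u': "u' \<in> cube 4" "f u' = u" "\<not> even_vertex u'"
    using pre[OF mem(3)] par by metis
  obtain v' where v': "v' \<in> cube 4" "f v' = v" "even_vertex v'"
    using pre[OF mem(4)] par by metis
  have "u' \<noteq> p'" "v' \<noteq> zero4" using p'(2) u'(2) v'(2) f(2) ne by auto
  then have "routable [zero4, p'] v' u'"
    using search_two_faults p' u' v' unfolding list_all_iff set_odd4 set_even4 by auto
  moreover have "v' \<in> cube 4 - set [zero4, p']" "set [zero4, p'] \<subseteq> cube 4"
    using v' p' \<open>v' \<noteq> zero4\<close> by (auto simp: cube_def)
  ultimately have "traceable (Q - f ` set [zero4, p']) (f v') (f u')"
    by (intro routable_embedding[OF f(1)])
  then have "traceable (Q - {p, q}) v u"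
    using f(2) p'(2) u'(2) v'(2) by (simp add: insert_commute)
  then show ?thesis by (rule traceable_rev)
qed

lemma cube4_minus_three:
  assumes Q: "cube_copy 4 Q" and mem: "g \<in> Q" "r \<in> Q" "r' \<in> Q" "a \<in> Q" "b \<in> Q"
    and par: "even_vertex r' = even_vertex r" "even_vertex g \<noteq> even_vertex r"
      "even_vertex a = even_vertex g" "even_vertex b = even_vertex g"
    and ne: "r \<noteq> r'" "a \<noteq> b" "a \<noteq> g" "b \<noteq> g"
  shows "traceable (Q - {g, r, r'}) a b"
proof -
  from embedding_at[OF Q mem(1)] obtain f where f: "embedding 4 f Q" "f zero4 = g"
    unfolding zero4_eq .
  note pre = embedding_zero4_preimage[OF f]
  obtain s where s: "s \<in> cube 4" "f s = r" "\<not> even_vertex s"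
    using pre[OF mem(2)] par by metis
  obtain s' where s': "s' \<in> cube 4" "f s' = r'" "\<not> even_vertex s'"
    using pre[OF mem(3)] par by metis
  obtain c where c: "c \<in> cube 4" "f c = a" "even_vertex c"
    using pre[OF mem(4)] par by metis
  obtain d where d: "d \<in> cube 4" "f d = b" "even_vertex d"
    using pre[OF mem(5)] par by metis
  have ne': "s \<noteq> s'" "c \<noteq> d" "c \<noteq> zero4" "d \<noteq> zero4" using s s' c d f(2) ne by auto
  have finish: "traceable (Q - {g, r, r'}) a b"
    if r: "routable [zero4, x, y] k l" and xy: "{x, y} = {s, s'}" and kl: "{k, l} = {c, d}" for x y k l
  proof -
    have "k \<in> cube 4 - set [zero4, x, y]" "set [zero4, x, y] \<subseteq> cube 4"
      using xy kl s s' c d ne'(3,4) by (auto simp: cube_def doubleton_eq_iff)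
    with r have "traceable (Q - f ` set [zero4, x, y]) (f k) (f l)"
      by (intro routable_embedding[OF f(1)])
    moreover have "f ` set [zero4, x, y] = {g, r, r'}"
      using xy s(2) s'(2) f(2) by (auto simp: doubleton_eq_iff)
    ultimately show ?thesis
      using kl c(2) d(2) traceable_rev by (auto simp: doubleton_eq_iff)
  qed
  obtain x y where xy: "{x, y} = {s, s'}"
    and *: "sorted_wrt (\<lambda>a b. routable [zero4, x, y] a b) even4"
    using sorted_wrt_distinct_pair[OF search_three_faults _ _ ne'(1)] s s'
    unfolding set_odd4 by blast
  obtain k l where "{k, l} = {c, d}" "routable [zero4, x, y] k l"
    using sorted_wrt_distinct_pair[OF * _ _ ne'(2)] c d ne'(3,4)
    unfolding set_even4 by blast
  with xy show ?thesis by (intro finish)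
qed

section \<open>The inductive step\<close>

text \<open>Cut between the deleted vertex \<open>p\<close> and the end \<open>u\<close> of the same parity; the four cases are the positions of
  \<open>q\<close> and \<open>v\<close>. Both faults in one half leave the other half complete, and the induction hypothesis
  covers the faulty one. With one fault in each half, the result on a single fault is enough: if \<open>v\<close> is
  with \<open>p\<close>, both halves are traversed between vertices of equal parity; if \<open>v\<close> is with \<open>u\<close>, a path through
  all of their half is cut open at \<open>q\<close>.\<close>

theorem cube_minus_two_traceable:
  assumes "cube_copy n Q" "4 \<le> n" "p \<in> Q" "q \<in> Q" "u \<in> Q" "v \<in> Q"
    "even_vertex p = even_vertex u" "even_vertex q = even_vertex v"
    "even_vertex p \<noteq> even_vertex q" "p \<noteq> u" "q \<noteq> v"
  shows "traceable (Q - {p, q}) u v"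
  using assms(2,1,3-)
proof (induction n arbitrary: Q p q u v rule: dec_induct)
  case base
  then show ?case by (intro cube4_minus_two) auto
next
  case (step n)
  note mem = step.prems(2-5) and par = step.prems(6-8) and ne = step.prems(9,10)
  from step.prems(1) mem(1,3) ne(1) obtain A B s
    where h: "halving n Q A B s" and pu: "p \<in> A" "u \<in> B" by (metis halving_exists)
  note hD = halvingD[OF h]
  have sp: "even_vertex (s x) \<longleftrightarrow> \<not> even_vertex x" if "x \<in> Q" for x
    using halving_parity[OF h that] .
  have inj: "x = s y" if "x \<in> Q" "y \<in> Q" "s x = y" for x y
    using hD(8) that by metis
  have big: "8 \<le> (2::nat) ^ (n - 1)" "16 \<le> (2::nat) ^ n"
    using power_increasing[of 3 "n - 1" "2::nat"] power_increasing[of 4 n "2::nat"] step.hyps(1) by auto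
  have n: "0 < n" using step.hyps(1) by simp
  \<comment> \<open>The induction hypothesis expects first the end of the parity of \<open>p\<close>; reversal makes the order immaterial.\<close>
  have IH: "traceable (A - {p, q}) x y"
    if "q \<in> A" "x \<in> A" "y \<in> A" "even_vertex x \<noteq> even_vertex y" "x \<notin> {p, q}" "y \<notin> {p, q}" for x y
  proof (cases "even_vertex x = even_vertex p")
    case True
    then show ?thesis using that par by (intro step.IH[OF hD(1) pu(1)]) auto
  next
    case False
    then have "traceable (A - {p, q}) y x"
      using that par by (intro step.IH[OF hD(1) pu(1)]) auto
    then show ?thesis by (rule traceable_rev)
  qed
  consider "q \<in> A" "v \<in> B" | "q \<in> A" "v \<in> A" | "q \<in> B" "v \<in> A" | "q \<in> B" "v \<in> B"
    using mem hD(3) by blast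
  then show ?case
  proof cases
    case 1
    have "traceable B u v" "finite {s p, s q}"
      using cube_laceable[OF hD(2) pu(2) 1(2)] par by auto
    moreover have "2 * card {s p, s q} + 2 \<le> card B"
      using cube_copy_card[OF hD(2)] big card_insert_le_m1[of 2 "{s q}" "s p"] by simp
    ultimately obtain x y V1 V2 where V: "B = V1 \<union> V2" "V1 \<inter> V2 = {}"
      "traceable V1 u x" "traceable V2 y v" "adj x y" "x \<notin> {s p, s q}" "y \<notin> {s p, s q}"
      by (rule traceable_cut_edge)
    have xy: "x \<in> B" "y \<in> B" using traceable_ends[OF V(3)] traceable_ends[OF V(4)] V(1) by auto
    have xyQ: "x \<in> Q" "y \<in> Q" using xy hD(3) by auto
    have "even_vertex (s x) \<noteq> even_vertex (s y)"
      using adj_parity[OF V(5)] sp xyQ by simp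
    moreover have "s x \<notin> {p, q}" "s y \<notin> {p, q}"
      using hD(8)[OF xyQ(1)] hD(8)[OF xyQ(2)] V(6,7) by auto
    ultimately have "traceable (A - {p, q}) (s x) (s y)"
      using 1 hD(6) xy by (intro IH) auto
    then have "traceable (V1 \<union> V2 \<union> (A - {p, q})) u v"
      by (intro traceable_detour[OF halving_sym[OF h] _ V(2-4)]) (auto simp: V(1))
    moreover have "V1 \<union> V2 \<union> (A - {p, q}) = Q - {p, q}"
      using V(1) hD(3,4) 1 pu by blast
    ultimately show ?thesis by simp
  next
    case 2
    obtain x where x: "x \<in> B" "even_vertex x = even_vertex v" "x \<notin> {s p}"
      using cube_copy_avoid[OF hD(2) n, of "{s p}" "even_vertex v"] big by auto
    have xQ: "x \<in> Q" using x(1) hD(3) by auto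
    have "traceable B u x"
      using cube_laceable[OF hD(2) pu(2) x(1)] x(2) par by auto
    moreover have "traceable (A - {p, q}) (s x) v"
    proof (rule IH[OF 2(1) hD(6)[OF x(1)] 2(2)])
      show "even_vertex (s x) \<noteq> even_vertex v" using sp[OF xQ] x(2) by simp
      then show "s x \<notin> {p, q}" using inj[OF xQ mem(1)] x(3) par by auto
      show "v \<notin> {p, q}" using par ne by auto
    qed
    ultimately have "traceable (B \<union> (A - {p, q})) u v"
      by (intro traceable_cross[OF halving_sym[OF h]]) auto
    moreover have "B \<union> (A - {p, q}) = Q - {p, q}"
      using hD(3,4) 2 pu by blast
    ultimately show ?thesis by simp
  next
    case 3
    have "card {v, s u} < 2 ^ (n - 1)"
      using big card_insert_le_m1[of 2 "{s u}" v] by simp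
    then obtain x where x: "x \<in> A" "even_vertex x = even_vertex v" "x \<notin> {v, s u}"
      using cube_copy_avoid[OF hD(1) n, of "{v, s u}" "even_vertex v"] by auto
    have xQ: "x \<in> Q" using x(1) hD(3) by auto
    have "traceable (A - {p}) v x"
      using cube_minus_vertex_traceable[OF hD(1) pu(1) 3(2) x(1)] x par by auto
    moreover have "traceable (B - {q}) (s x) u"
      using cube_minus_vertex_traceable[OF hD(2) 3(1) hD(5)[OF x(1)] pu(2)]
        x sp[OF xQ] inj[OF xQ mem(3)] par by auto
    ultimately have "traceable ((A - {p}) \<union> (B - {q})) v u"
      by (intro traceable_cross[OF h]) auto
    moreover have "(A - {p}) \<union> (B - {q}) = Q - {p, q}"
      using hD(3,4) 3 pu by blast
    ultimately show ?thesis using traceable_rev by simp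
  next
    case 4
    have "traceable B u v"
      using cube_laceable[OF hD(2) pu(2) 4(2)] par by auto
    moreover note 4(1)
    moreover have "q \<noteq> u" using par by auto
    moreover note ne(2)
    ultimately obtain x y V1 V2 where V: "B - {q} = V1 \<union> V2" "V1 \<inter> V2 = {}"
      "traceable V1 u x" "traceable V2 y v" "adj x q" "adj q y"
      by (rule traceable_cut_vertex)
    have xy: "x \<in> V1" "y \<in> V2" "x \<in> B" "y \<in> B"
      using traceable_ends[OF V(3)] traceable_ends[OF V(4)] V(1) by auto
    have xyQ: "x \<in> Q" "y \<in> Q" using xy hD(3) by auto
    have "x \<noteq> y" using xy V(2) by blast
    then have "s x \<noteq> s y" using hD(8) xyQ by metis
    moreover have "even_vertex (s x) = even_vertex q" "even_vertex (s y) = even_vertex q"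
      using adj_parity[OF V(5)] adj_parity[OF V(6)] sp xyQ by auto
    ultimately have "traceable (A - {p}) (s x) (s y)"
      using par xy hD(6) by (intro cube_minus_vertex_traceable[OF hD(1) pu(1)]) auto
    then have "traceable (V1 \<union> V2 \<union> (A - {p})) u v"
      by (intro traceable_detour[OF halving_sym[OF h] _ V(2-4)]) (use V(1) in auto)
    moreover have "V1 \<union> V2 \<union> (A - {p}) = Q - {p, q}"
      using V(1) hD(3,4) 4 pu by blast
    ultimately show ?thesis by simp
  qed
qed

text \<open>The combination of the two halves when \<open>g\<close> and \<open>r\<close> are in the same one; the case of both ends in
  \<open>A\<close> treats \<open>g\<close> first as an ordinary vertex and removes it from the path afterwards.\<close>

lemma cube_minus_three_halved:
  assumes h: "halving n Q A B s" and n: "4 \<le> n"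
    and mem: "g \<in> A" "r \<in> A" "r' \<in> B" "a \<in> Q" "b \<in> Q"
    and par: "even_vertex r' = even_vertex r" "even_vertex g \<noteq> even_vertex r"
      "even_vertex a = even_vertex g" "even_vertex b = even_vertex g"
    and ne: "a \<noteq> b" "a \<noteq> g" "b \<noteq> g"
  shows "traceable (Q - {g, r, r'}) a b"
proof -
  note hD = halvingD[OF h]
  have memQ: "g \<in> Q" "r \<in> Q" "r' \<in> Q" using mem hD(3) by auto
  have sp: "even_vertex (s x) \<longleftrightarrow> \<not> even_vertex x" if "x \<in> Q" for x
    using halving_parity[OF h that] .
  have inj: "x = s y" if "x \<in> Q" "y \<in> Q" "s x = y" for x y
    using hD(8) that by metis
  have big: "8 \<le> (2::nat) ^ (n - 1)" "16 \<le> (2::nat) ^ n"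
    using power_increasing[of 3 "n - 1" "2::nat"] power_increasing[of 4 n "2::nat"] n by auto
  have two: "traceable (A - {g, r}) x y"
    if "x \<in> A" "y \<in> A" "even_vertex x \<noteq> even_vertex y" "x \<notin> {g, r}" "y \<notin> {g, r}" for x y
  proof (cases "even_vertex x = even_vertex g")
    case True
    then show ?thesis using that par mem
      by (intro cube_minus_two_traceable[OF hD(1) n]) auto
  next
    case False
    then have "traceable (A - {g, r}) y x"
      using that par mem by (intro cube_minus_two_traceable[OF hD(1) n]) auto
    then show ?thesis by (rule traceable_rev)
  qed
  \<comment> \<open>One end in each half. The crossing edge must not lead from \<open>B\<close> to the deleted vertex \<open>r\<close>.\<close>
  have apart: "traceable (Q - {g, r, r'}) k l"
    if kl: "k \<in> B" "l \<in> A" "even_vertex k = even_vertex g" "even_vertex l = even_vertex g" "l \<noteq> g" for k l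
  proof -
    have "card {k, s r} < 2 ^ (n - 1)"
      using big card_insert_le_m1[of 2 "{s r}" k] by simp
    then obtain x where x: "x \<in> B" "even_vertex x = even_vertex g" "x \<notin> {k, s r}"
      using cube_copy_avoid[OF hD(2), of "{k, s r}" "even_vertex g"] n by auto
    have xQ: "x \<in> Q" using x(1) hD(3) by auto
    have "traceable (B - {r'}) k x"
      using cube_minus_vertex_traceable[OF hD(2) mem(3) kl(1) x(1)] x kl par by auto
    moreover have "traceable (A - {g, r}) (s x) l"
    proof (rule two[OF hD(6)[OF x(1)] kl(2)])
      show "even_vertex (s x) \<noteq> even_vertex l" using sp[OF xQ] x(2) kl by simp
      then show "s x \<notin> {g, r}" using inj[OF xQ memQ(2)] x(3) kl by auto
      show "l \<notin> {g, r}" using kl par by auto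
    qed
    ultimately have "traceable ((B - {r'}) \<union> (A - {g, r})) k l"
      by (intro traceable_cross[OF halving_sym[OF h]]) auto
    moreover have "(B - {r'}) \<union> (A - {g, r}) = Q - {g, r, r'}"
      using hD(3,4) mem by blast
    ultimately show ?thesis by simp
  qed
  consider "a \<in> B" "b \<in> B" | "a \<in> A" "b \<in> A" | "a \<in> B" "b \<in> A" | "a \<in> A" "b \<in> B"
    using mem hD(3) by blast
  then show ?thesis
  proof cases
    case 1
    have "traceable (B - {r'}) a b" "finite {s g, s r}"
      using cube_minus_vertex_traceable[OF hD(2) mem(3) 1] ne par by auto
    moreover have "2 * card {s g, s r} + 2 \<le> card (B - {r'})"
      using cube_copy_card[OF hD(2)] cube_copy_finite[OF hD(2)] mem(3) big
        card_insert_le_m1[of 2 "{s r}" "s g"] by simp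
    ultimately obtain x y V1 V2 where V: "B - {r'} = V1 \<union> V2" "V1 \<inter> V2 = {}"
      "traceable V1 a x" "traceable V2 y b" "adj x y" "x \<notin> {s g, s r}" "y \<notin> {s g, s r}"
      by (rule traceable_cut_edge)
    have xy: "x \<in> B" "y \<in> B" using traceable_ends[OF V(3)] traceable_ends[OF V(4)] V(1) by auto
    have xyQ: "x \<in> Q" "y \<in> Q" using xy hD(3) by auto
    have "even_vertex (s x) \<noteq> even_vertex (s y)"
      using adj_parity[OF V(5)] sp xyQ by simp
    moreover have "s x \<notin> {g, r}" "s y \<notin> {g, r}"
      using hD(8)[OF xyQ(1)] hD(8)[OF xyQ(2)] V(6,7) by auto
    ultimately have "traceable (A - {g, r}) (s x) (s y)"
      using hD(6) xy by (intro two) auto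
    then have "traceable (V1 \<union> V2 \<union> (A - {g, r})) a b"
      by (intro traceable_detour[OF halving_sym[OF h] _ V(2-4)]) (use V(1) in auto)
    moreover have "V1 \<union> V2 \<union> (A - {g, r}) = Q - {g, r, r'}"
      using V(1) hD(3,4) mem by blast
    ultimately show ?thesis by simp
  next
    case 2
    have "traceable (A - {r}) a b"
      using cube_minus_vertex_traceable[OF hD(1) mem(2) 2] ne par by auto
    moreover have "g \<in> A - {r}" "g \<noteq> a" "g \<noteq> b" using mem(1) par ne by auto
    ultimately obtain x y V1 V2 where V: "A - {r} - {g} = V1 \<union> V2" "V1 \<inter> V2 = {}"
      "traceable V1 a x" "traceable V2 y b" "adj x g" "adj g y"
      by (rule traceable_cut_vertex)
    have xy: "x \<in> V1" "y \<in> V2" "x \<in> A" "y \<in> A"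
      using traceable_ends[OF V(3)] traceable_ends[OF V(4)] V(1) by auto
    have xyQ: "x \<in> Q" "y \<in> Q" using xy hD(3) by auto
    have "x \<noteq> y" using xy V(2) by blast
    then have "s x \<noteq> s y" using hD(8) xyQ by metis
    moreover have "even_vertex (s x) = even_vertex g" "even_vertex (s y) = even_vertex g"
      using adj_parity[OF V(5)] adj_parity[OF V(6)] sp xyQ by auto
    ultimately have "traceable (B - {r'}) (s x) (s y)"
      using par xy hD(5) by (intro cube_minus_vertex_traceable[OF hD(2) mem(3)]) auto
    then have "traceable (V1 \<union> V2 \<union> (B - {r'})) a b"
      by (intro traceable_detour[OF h _ V(2-4)]) (use V(1) in auto)
    moreover have "V1 \<union> V2 \<union> (B - {r'}) = Q - {g, r, r'}"
      using V(1) hD(3,4) mem by blast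
    ultimately show ?thesis by simp
  next
    case 3
    then show ?thesis using par ne by (intro apart)
  next
    case 4
    then have "traceable (Q - {g, r, r'}) b a" using par ne by (intro apart)
    then show ?thesis by (rule traceable_rev)
  qed
qed

theorem cube_minus_three_traceable:
  assumes Q: "cube_copy n Q" "4 \<le> n" and mem: "g \<in> Q" "r \<in> Q" "r' \<in> Q" "a \<in> Q" "b \<in> Q"
    and par: "even_vertex r' = even_vertex r" "even_vertex g \<noteq> even_vertex r"
      "even_vertex a = even_vertex g" "even_vertex b = even_vertex g"
    and ne: "r \<noteq> r'" "a \<noteq> b" "a \<noteq> g" "b \<noteq> g"
  shows "traceable (Q - {g, r, r'}) a b"
proof (cases "n = 4")
  case True
  then show ?thesis using assms by (intro cube4_minus_three) auto
next
  case False
  then obtain m where m: "n = Suc m" "4 \<le> m" using Q(2) by (cases n) auto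
  from Q(1) mem(2,3) ne(1) obtain A B s where h: "halving m Q A B s" and rr: "r \<in> A" "r' \<in> B"
    unfolding m(1) by (metis halving_exists)
  show ?thesis
  proof (cases "g \<in> A")
    case True
    then show ?thesis
      by (intro cube_minus_three_halved[OF h m(2) _ rr]) (use mem par ne in auto)
  next
    case False
    then have "g \<in> B" using mem(1) halvingD(3)[OF h] by blast
    then have "traceable (Q - {g, r', r}) a b"
      by (intro cube_minus_three_halved[OF halving_sym[OF h] m(2) _ rr(2,1)])
        (use mem par ne in auto)
    then show ?thesis by (simp add: insert_commute)
  qed
qed

section \<open>Prescribed ends for a fault of mass three and charge one\<close>

text \<open>Two paths with the same pair of ends share these ends, so a covering with one pair of ends is one path.\<close>

lemma path_covering_one_pair_iff:
  "(\<exists>X. path_covering V X \<and> ends ` X = {{u, v}}) \<longleftrightarrow> traceable V u v"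
proof
  assume "\<exists>X. path_covering V X \<and> ends ` X = {{u, v}}"
  then obtain X where X: "path_covering V X" "ends ` X = {{u, v}}" by blast
  then obtain p where p: "p \<in> X" by blast
  have path: "q \<noteq> []" "distinct q" "successively adj q" if "q \<in> X" for q
    using X(1) that by (auto simp: path_covering_def path_in_def)
  have ends: "ends q = {u, v}" if "q \<in> X" for q using X(2) that by blast
  have "q = p" if q: "q \<in> X" for q
  proof (rule ccontr)
    assume "q \<noteq> p"
    with X(1) q p have "disjnt (set q) (set p)"
      unfolding path_covering_def pairwise_def by blast
    moreover have "hd p \<in> set q"
      using ends[OF p] ends[OF q] path(1)[OF q] unfolding ends_def
      by (metis hd_in_set insertCI insertE last_in_set singletonD)
    moreover have "hd p \<in> set p" using path(1)[OF p] by simp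
    ultimately show False by (auto simp: disjnt_iff)
  qed
  with p have "X = {p}" by blast
  with X(1) have "set p = V" by (simp add: path_covering_def)
  then have "traceable V (hd p) (last p)"
    using path[OF p] by (intro traceableI[of p]) auto
  moreover have "{hd p, last p} = {u, v}" using ends[OF p] by (simp add: ends_def)
  ultimately show "traceable V u v"
    using traceable_rev by (auto simp: doubleton_eq_iff)
next
  assume "traceable V u v"
  then obtain p where p: "hamiltonian_path V p" "hd p = u" "last p = v"
    unfolding traceable_def by blast
  then have "path_covering V {p} \<and> ends ` {p} = {{u, v}}"
    by (auto simp: path_covering_def hamiltonian_path_def ends_def)
  then show "\<exists>X. path_covering V X \<and> ends ` X = {{u, v}}" by blast
qed

text \<open>Three vertices of charge one split as two of one parity and one of the other. The single vertex \<open>g\<close> may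
  have either colour, which decides the sign of the charge.\<close>

lemma unit_charge_fault:
  assumes "mass F = 3" "charge c F = 1"
  obtains g r r' where "F = {g, r, r'}" "r \<noteq> r'" "even_vertex r' = even_vertex r"
    "even_vertex g \<noteq> even_vertex r" "signed_charge c F = (if green c g then 1 else - 1)"
proof -
  define R where "R = {v \<in> F. red c v}"
  define G where "G = {v \<in> F. green c v}"
  have F: "F = R \<union> G" "R \<inter> G = {}" by (auto simp: R_def G_def green_def)
  have "finite F" using assms(1) card_ge_0_finite[of F] by (simp add: mass_def)
  then have "card R + card G = 3"
    using assms(1) F card_Un_disjoint[of R G] by (simp add: mass_def)
  moreover have signed: "signed_charge c F = int (card R) - int (card G)"
    by (simp add: signed_charge_def R_def G_def)
  moreover from this have "\<bar>int (card R) - int (card G)\<bar> = 1"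
    using assms(2) by (simp add: charge_def)
  ultimately consider "card R = 2" "card G = 1" | "card R = 1" "card G = 2" by linarith
  then show thesis
  proof cases
    case 1
    then obtain r r' g where *: "R = {r, r'}" "r \<noteq> r'" "G = {g}"
      by (auto simp: card_2_iff card_1_singleton_iff)
    then have "red c r" "red c r'" "green c g" using R_def G_def by auto
    with * 1 signed F(1) show thesis
      by (intro that[of g r r']) (auto simp: red_def green_def)
  next
    case 2
    then obtain r r' g where *: "G = {r, r'}" "r \<noteq> r'" "R = {g}"
      by (auto simp: card_2_iff card_1_singleton_iff)
    then have "green c r" "green c r'" "red c g" using R_def G_def by auto
    with * 2 signed F(1) show thesis
      by (intro that[of g r r']) (auto simp: red_def green_def)
  qed
qed

text \<open>Without neutral pairs the single charged pair has to compensate the charge of the fault, so it has the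
  colour that occurs only once in the fault, that of \<open>g\<close>.\<close>

lemma prescription_one_charged_iff:
  assumes sc: "signed_charge c F = (if green c g then 1 else - 1)"
  shows "prescription c n F 0 1 E \<longleftrightarrow>
    (\<exists>u v. E = {{u, v}} \<and> u \<noteq> v \<and> u \<in> cube n - F \<and> v \<in> cube n - F \<and>
       even_vertex u = even_vertex g \<and> even_vertex v = even_vertex g)"
    (is "_ \<longleftrightarrow> ?R")
proof
  assume "prescription c n F 0 1 E"
  then have dis: "disjoint_pairs E" and sub: "\<Union>E \<subseteq> cube n - F"
    and bal: "signed_charge c F
       = int (card {P \<in> E. green_pair c P}) - int (card {P \<in> E. red_pair c P})"
    and card: "card {P \<in> E. neutral_pair P} = 0" "card {P \<in> E. charged_pair P} = 1"
    unfolding prescription_def in_balance_def by blast+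
  have "E \<subseteq> Pow (cube n)" using sub by blast
  then have fin: "finite E" by (rule finite_subset) simp
  then have no_neutral: "\<not> neutral_pair P" if "P \<in> E" for P using that card(1) by auto
  have "charged_pair P" if "P \<in> E" for P
  proof -
    have "card P = 2" using dis that by (auto simp: disjoint_pairs_def)
    then obtain u v where "P = {u, v}" "u \<noteq> v" by (auto simp: card_2_iff)
    then show ?thesis using no_neutral[OF that] unfolding neutral_pair_def charged_pair_def by blast
  qed
  then have "{P \<in> E. charged_pair P} = E" by blast
  with card(2) obtain P where E: "E = {P}" by (metis card_1_singletonE)
  with \<open>{P \<in> E. charged_pair P} = E\<close> have "charged_pair P" by blast
  then obtain u v where uv: "P = {u, v}" "u \<noteq> v" "even_vertex u = even_vertex v"
    unfolding charged_pair_def by blast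
  have "even_vertex u = even_vertex g"
  proof (cases "green c g")
    case True
    then have "{P \<in> E. green_pair c P} \<noteq> {}" using sc bal by (intro notI) simp
    then have "green c u" using E uv by (auto simp: green_pair_def)
    with True show ?thesis by (auto simp: green_def red_def)
  next
    case False
    then have "{P \<in> E. red_pair c P} \<noteq> {}" using sc bal by (intro notI) simp
    then have "red c u" using E uv by (auto simp: red_pair_def)
    with False show ?thesis by (auto simp: green_def red_def)
  qed
  then show ?R using E uv sub by blast
next
  assume ?R
  then obtain u v where E: "E = {{u, v}}" and uv: "u \<noteq> v" "{u, v} \<subseteq> cube n - F"
    "even_vertex u = even_vertex g" "even_vertex v = even_vertex g" by blast
  have ch: "charged_pair {u, v}" using uv unfolding charged_pair_def by metis
  have "\<not> neutral_pair {u, v}" using uv by (auto simp: neutral_pair_def doubleton_eq_iff)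
  then have sets: "{P \<in> E. neutral_pair P} = {}" "{P \<in> E. charged_pair P} = E"
    "{P \<in> E. green_pair c P} = (if green c g then E else {})"
    "{P \<in> E. red_pair c P} = (if green c g then {} else E)"
    using ch uv(3,4) by (auto simp: E green_pair_def red_pair_def green_def red_def)
  have "disjoint_pairs E" "card E = 1" using uv(1) by (auto simp: E disjoint_pairs_def)
  with sets sc uv(2) show "prescription c n F 0 1 E"
    by (auto simp: prescription_def in_balance_def E)
qed

lemma freely_prescribable_mass3:
  assumes n: "4 \<le> n" and F: "fault n F" "mass F = 3" "charge c F = 1"
  shows "freely_prescribable c n F 0 1"
proof -
  from unit_charge_fault[OF F(2,3)] obtain g r r' where G: "F = {g, r, r'}" "r \<noteq> r'"
    "even_vertex r' = even_vertex r" "even_vertex g \<noteq> even_vertex r"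
    and sc: "signed_charge c F = (if green c g then 1 else - 1)" .
  note iff = prescription_one_charged_iff[OF sc]
  have mem: "g \<in> cube n" "r \<in> cube n" "r' \<in> cube n" using F(1) G(1) by (auto simp: fault_def)
  have big: "8 \<le> (2::nat) ^ (n - 1)"
    using power_increasing[of 3 "n - 1" "2::nat"] n by auto
  obtain u where u: "u \<in> cube n" "even_vertex u = even_vertex g" "u \<notin> {g}"
    using cube_copy_avoid[OF cube_copy_cube, of n "{g}" "even_vertex g"] n big by auto
  obtain v where v: "v \<in> cube n" "even_vertex v = even_vertex g" "v \<notin> {g, u}"
    using cube_copy_avoid[OF cube_copy_cube, of n "{g, u}" "even_vertex g"] n big u(3) by auto
  have "prescription c n F 0 1 {{u, v}}"
    unfolding iff using u v G by (intro exI[of _ u] exI[of _ v]) auto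
  moreover have "\<exists>X. path_covering (cube n - F) X \<and> ends ` X = E"
    if E: "prescription c n F 0 1 E" for E
  proof -
    from E obtain a b where ab: "E = {{a, b}}" "a \<noteq> b" "a \<in> cube n - F" "b \<in> cube n - F"
      "even_vertex a = even_vertex g" "even_vertex b = even_vertex g"
      unfolding iff by blast
    have "traceable (cube n - F) a b"
      unfolding G(1) using ab G mem
      by (intro cube_minus_three_traceable[OF cube_copy_cube n]) auto
    then show ?thesis unfolding ab(1) path_covering_one_pair_iff .
  qed
  ultimately show ?thesis unfolding freely_prescribable_def by blast
qed

section \<open>The three-dimensional cube\<close>

text \<open>Only one of the three neighbours of the vertex with entries \<open>b\<close>, \<open>True\<close>, \<open>True\<close> survives, but an inner
  vertex of a path needs two. The first entry \<open>b\<close> allows the same configuration in either parity.\<close>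

lemma cube3_obstruction:
  "\<not> traceable (cube 3 - {[b, False, False], [b, True, False], [b, False, True]})
     [\<not> b, False, True] [\<not> b, True, False]"
    (is "\<not> traceable ?V ?a ?b")
proof
  assume tr: "traceable ?V ?a ?b"
  let ?g = "[b, True, True]"
  have only: "x = [\<not> b, True, True]" if "x \<in> ?V" "adj x ?g" for x
    using that by (auto simp: cube_def numeral_eq_Suc length_Suc_conv adj_Cons split: if_splits)
  have "?g \<in> ?V" "?g \<noteq> ?a" "?g \<noteq> ?b" by (auto simp: cube_def)
  from traceable_cut_vertex[OF tr this] obtain x y V1 V2 where
    V: "?V - {?g} = V1 \<union> V2" "V1 \<inter> V2 = {}" "traceable V1 ?a x" "traceable V2 y ?b"
    "adj x ?g" "adj ?g y" .
  have "x \<in> V1" "y \<in> V2" using traceable_ends V(3,4) by blast+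
  moreover from this have "x \<in> ?V" "y \<in> ?V" using V(1) by blast+
  then have "x = y" using only V(5) adj_sym[OF V(6)] by metis
  ultimately show False using V(2) by blast
qed

lemma not_freely_prescribable_cube3:
  "\<exists>F. fault 3 F \<and> mass F = 3 \<and> charge c F = 1 \<and> \<not> freely_prescribable c 3 F 0 1"
proof -
  let ?g = "[c, False, False]" and ?r = "[c, True, False]" and ?r' = "[c, False, True]"
  let ?a = "[\<not> c, False, True]" and ?b = "[\<not> c, True, False]"
  let ?F = "{?g, ?r, ?r'}"
  have F: "fault 3 ?F" "mass ?F = 3" by (auto simp: fault_def cube_def mass_def)
  have "{v \<in> ?F. red c v} = {?r, ?r'}" "{v \<in> ?F. green c v} = {?g}"
    by (auto simp: red_def green_def even_vertex_Cons split: if_splits)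
  then have sc: "signed_charge c ?F = 1" by (simp add: signed_charge_def)
  have "green c ?g" by (simp add: red_def green_def even_vertex_Cons)
  with sc have sc': "signed_charge c ?F = (if green c ?g then 1 else - 1)" by simp
  have "prescription c 3 ?F 0 1 {{?a, ?b}}"
    unfolding prescription_one_charged_iff[OF sc']
    by (intro exI[of _ ?a] exI[of _ ?b]) (auto simp: cube_def even_vertex_Cons)
  moreover have "\<not> (\<exists>X. path_covering (cube 3 - ?F) X \<and> ends ` X = {{?a, ?b}})"
    unfolding path_covering_one_pair_iff by (rule cube3_obstruction)
  ultimately have "\<not> freely_prescribable c 3 ?F 0 1"
    unfolding freely_prescribable_def by blast
  moreover have "charge c ?F = 1" using sc by (simp add: charge_def)
  ultimately show ?thesis using F by blast
qed

lemma four_admissible: "4 \<in> admissible c 3 1 0 1"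
proof -
  have "log 2 6 \<le> (4::real)" by (subst log_le_iff) (auto simp: powr_numeral)
  then show ?thesis using freely_prescribable_mass3 by (auto simp: admissible_def)
qed

lemma admissible_ge_four:
  assumes m: "m \<in> admissible c 3 1 0 1"
  shows "4 \<le> m"
proof (rule ccontr)
  assume "\<not> 4 \<le> m"
  moreover have "\<not> m \<le> 2"
  proof
    assume "m \<le> 2"
    \<comment> \<open>Here \<open>6\<close> is \<open>M + C + 2 N + 2 O\<close>.\<close>
    have "(2::real) < log 2 6" by (subst less_log_iff) (auto simp: powr_numeral)
    moreover have "log 2 6 \<le> real m" using m by (simp add: admissible_def)
    ultimately show False using \<open>m \<le> 2\<close> by linarith
  qed
  ultimately have "m = 3" by simp
  then show False using m not_freely_prescribable_cube3[of c] by (auto simp: admissible_def)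
qed

theorem lemma3p13:
  fixes c :: bool
  shows "(admissible c 3 1 0 1 \<noteq> {} \<and> bracket c 3 1 0 1 = 4) \<and>
    (\<forall>n\<ge>4. \<forall>g r r1 g1 g2.
       g \<in> cube n \<and> r \<in> cube n \<and> r1 \<in> cube n \<and>
       green c g \<and> red c r \<and> red c r1 \<and> r \<noteq> r1 \<and>
       g1 \<in> cube n - {g, r, r1} \<and> g2 \<in> cube n - {g, r, r1} \<and>
       green c g1 \<and> green c g2 \<and> g1 \<noteq> g2 \<longrightarrow>
       (\<exists>p. hamiltonian_path (cube n - {g, r, r1}) p \<and> hd p = g1 \<and> last p = g2)) \<and>
    (\<exists>g r r1 g1 g2.
       g \<in> cube 3 \<and> r \<in> cube 3 \<and> r1 \<in> cube 3 \<and>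
       green c g \<and> red c r \<and> red c r1 \<and> r \<noteq> r1 \<and>
       g1 \<in> cube 3 - {g, r, r1} \<and> g2 \<in> cube 3 - {g, r, r1} \<and>
       green c g1 \<and> green c g2 \<and> g1 \<noteq> g2 \<and>
       \<not> (\<exists>p. hamiltonian_path (cube 3 - {g, r, r1}) p \<and> hd p = g1 \<and> last p = g2))"
  unfolding traceable_def[symmetric]
proof (intro conjI allI impI)
  show "admissible c 3 1 0 1 \<noteq> {}" using four_admissible by blast
  show "bracket c 3 1 0 1 = 4"
    unfolding bracket_def
    using four_admissible admissible_ge_four by (rule Least_equality)
next
  fix n :: nat and g r r1 g1 g2
  assume n: "4 \<le> n" and
    "g \<in> cube n \<and> r \<in> cube n \<and> r1 \<in> cube n \<and>
     green c g \<and> red c r \<and> red c r1 \<and> r \<noteq> r1 \<and>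
     g1 \<in> cube n - {g, r, r1} \<and> g2 \<in> cube n - {g, r, r1} \<and>
     green c g1 \<and> green c g2 \<and> g1 \<noteq> g2"
  then show "traceable (cube n - {g, r, r1}) g1 g2"
    by (intro cube_minus_three_traceable[OF cube_copy_cube n]) (auto simp: green_def red_def)
next
  show "\<exists>g r r1 g1 g2.
       g \<in> cube 3 \<and> r \<in> cube 3 \<and> r1 \<in> cube 3 \<and>
       green c g \<and> red c r \<and> red c r1 \<and> r \<noteq> r1 \<and>
       g1 \<in> cube 3 - {g, r, r1} \<and> g2 \<in> cube 3 - {g, r, r1} \<and>
       green c g1 \<and> green c g2 \<and> g1 \<noteq> g2 \<and> \<not> traceable (cube 3 - {g, r, r1}) g1 g2"
  proof (intro exI conjI)
    show "\<not> traceable (cube 3 - {[c, False, False], [c, True, False], [c, False, True]})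
        [\<not> c, False, True] [\<not> c, True, False]"
      by (rule cube3_obstruction)
  qed (auto simp: cube_def red_def green_def even_vertex_Cons)
qed

end
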